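(* For $n\in\mathbb{N}=\{1,2,\dots\}$ and $1\le k\le n$ let $m_n^{(k)}:=|\{(\pi,\rho)\in NC(n)^2\mid M_{\pi,\rho}\text{ has exactly } k \text{ orbits}\}|$. Let $\nu:\mathbb{C}[X]\to\mathbb{C}$ be the linear functional with $\nu(1)=1$ whose free cumulants are $\kappa_{2n-1}(\nu)=0$ and $\kappa_{2n}(\nu)=m_n^{(1)}$ for all $n\in\mathbb{N}$. For $t\in(0,\infty)$ let $\nu_t:\mathbb{C}[X]\to\mathbb{C}$ be the linear functional with $\nu_t(1)=1$ and with moments $\nu_t(X^{2n-1})=0$ and $\nu_t(X^{2n})=\sum_{k=1}^n m_n^{(k)}t^k$ for all $n\in\mathbb{N}$. Then $$\lim_{t\to0}\nu_t^{\boxplus 1/t}=\nu\quad\text{in moments},$$ that is, $\lim_{t\to0}\nu_t^{\boxplus 1/t}(X^n)=\nu(X^n)$ for every $n\in\mathbb{N}$ (the limit being over $t \in (0,\infty)$, $t\to 0$).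
   Context: $NC(n)$ is the set of non-crossing partitions of $\{1,\dots,n\}$: partitions for which there are no two distinct blocks $V,W$ and $a<b<c<d$ with $a,c\in V$ and $b,d\in W$. For $\pi\in NC(n)$, $P_\pi$ denotes the permutation of $\{1,\dots,n\}$ whose orbits are the blocks of $\pi$ and which performs an increasing cycle on each block: for a block $\{i_1<\dots<i_k\}$, $P_\pi(i_1)=i_2,\dots,P_\pi(i_{k-1})=i_k$, $P_\pi(i_k)=i_1$. For $\pi,\rho\in NC(n)$, the meandric system $M_{\pi,\rho}$ is the permutation of $\{1,\dots,2n\}$ given by $M_{\pi,\rho}(2i-1)=2P_\pi^{-1}(i)$ and $M_{\pi,\rho}(2i)=2P_\rho(i)-1$ for $1\le i\le n$. For a linear functional $\mu:\mathbb{C}[X]\to\mathbb{C}$ with $\mu(1)=1$, the free cumulants $(\kappa_n(\mu))_{n\ge1}$ are the complex numbers uniquely determined by $$\mu(X^n)=\sum_{\pi\in NC(n)}\ \prod_{V\in\pi}\kappa_{|V|}(\mu),\qquad n\in\mathbb{N},$$ the product being over the blocks $V$ of $\pi$. Any sequence of complex numbers is the sequence of free cumulants of a unique such functional. The $R$-transform of $\mu$ is the formal power series $R_\mu(z)=\sum_{n\ge1}\kappa_n(\mu)z^n$. For $s\in(0,\infty)$, $\mu^{\boxplus s}$ denotes the linear functional on $\mathbb{C}[X]$ sending $1$ to $1$ and uniquely determined by $R_{\mu^{\boxplus s}}(z)=sR_\mu(z)$, i.e. $\kappa_n(\mu^{\boxplus s})=s\,\kappa_n(\mu)$ for all $n$.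 *)

theory Defs
  imports
    "HOL-Analysis.Analysis"
    "HOL-Combinatorics.Orbits"
    "HOL-Computational_Algebra.Polynomial"
    "HOL-Computational_Algebra.Formal_Power_Series"
begin

section \<open>Non-crossing partitions and meandric systems\<close>

definition noncrossing :: "nat set set \<Rightarrow> bool" where
  "noncrossing \<pi> \<longleftrightarrow>
     \<not> (\<exists>V\<in>\<pi>. \<exists>W\<in>\<pi>. V \<noteq> W \<and>
          (\<exists>a b c d. a < b \<and> b < c \<and> c < d \<and> a \<in> V \<and> c \<in> V \<and> b \<in> W \<and> d \<in> W))"

definition NC :: "nat \<Rightarrow> nat set set set" where
  "NC n = {\<pi>. partition_on {1..n} \<pi> \<and> noncrossing \<pi>}"

text \<open>For a partition, the union below is the unique block containing \<open>i\<close>; it is empty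
  when \<open>i\<close> lies in no block, and such points are fixed.\<close>

definition block_of :: "nat set set \<Rightarrow> nat \<Rightarrow> nat set" where
  "block_of \<pi> i = \<Union>{V\<in>\<pi>. i \<in> V}"

definition nc_perm :: "nat set set \<Rightarrow> nat \<Rightarrow> nat" where
  "nc_perm \<pi> i =
     (let V = block_of \<pi> i
      in if V = {} then i
         else if i = Max V then Min V
         else Min {j\<in>V. i < j})"

definition meandric_system :: "nat \<Rightarrow> nat set set \<Rightarrow> nat set set \<Rightarrow> nat \<Rightarrow> nat" where
  "meandric_system n \<pi> \<rho> j =
     (if j \<notin> {1..2*n} then j
      else if odd j then 2 * inv (nc_perm \<pi>) ((j + 1) div 2)
      else 2 * nc_perm \<rho> (j div 2) - 1)"

definition num_orbits :: "nat \<Rightarrow> nat set set \<Rightarrow> nat set set \<Rightarrow> nat" where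
  "num_orbits n \<pi> \<rho> = card (orbit (meandric_system n \<pi> \<rho>) ` {1..2*n})"

definition meandric_number :: "nat \<Rightarrow> nat \<Rightarrow> nat" where
  "meandric_number n k = card {(\<pi>, \<rho>). \<pi> \<in> NC n \<and> \<rho> \<in> NC n \<and> num_orbits n \<pi> \<rho> = k}"


section \<open>Functionals on polynomials and their free cumulants\<close>

definition unital_functional :: "(complex poly \<Rightarrow> complex) \<Rightarrow> bool" where
  "unital_functional \<mu> \<longleftrightarrow> Vector_Spaces.linear smult (*) \<mu> \<and> \<mu> 1 = 1"

abbreviation moment :: "(complex poly \<Rightarrow> complex) \<Rightarrow> nat \<Rightarrow> complex" where
  "moment \<mu> n \<equiv> \<mu> (monom 1 n)"

text \<open>Free cumulants are indexed by positive integers; the entry at \<open>0\<close> is fixed to be \<open>0\<close>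
  so that the sequence is unique.\<close>

definition free_cumulant :: "(complex poly \<Rightarrow> complex) \<Rightarrow> nat \<Rightarrow> complex" where
  "free_cumulant \<mu> =
     (THE \<kappa>. \<kappa> 0 = 0 \<and> (\<forall>n\<ge>1. moment \<mu> n = (\<Sum>\<pi>\<in>NC n. \<Prod>V\<in>\<pi>. \<kappa> (card V))))"

definition R_transform :: "(complex poly \<Rightarrow> complex) \<Rightarrow> complex fps" where
  "R_transform \<mu> = Abs_fps (\<lambda>n. if n = 0 then 0 else free_cumulant \<mu> n)"

definition free_conv_power :: "(complex poly \<Rightarrow> complex) \<Rightarrow> real \<Rightarrow> (complex poly \<Rightarrow> complex)" where
  "free_conv_power \<mu> s =
     (THE \<eta>. unital_functional \<eta> \<and> R_transform \<eta> = fps_const (of_real s) * R_transform \<mu>)"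


section \<open>Well-definedness\<close>

lemma finite_block: "\<lbrakk>\<pi> \<in> NC n; V \<in> \<pi>\<rbrakk> \<Longrightarrow> finite V"
  unfolding NC_def by (metis (no_types, lifting) Union_upper finite_atLeastAtMost finite_subset mem_Collect_eq partition_onD1)

lemma finite_NC: "finite (NC n)"
  unfolding NC_def using finitely_many_partition_on[of "{1..n}"] by simp

lemma block_of_eq:
  assumes "\<pi> \<in> NC n" "V \<in> \<pi>" "i \<in> V"
  shows "block_of \<pi> i = V"
proof -
  have "{W\<in>\<pi>. i \<in> W} = {V}"
    using assms unfolding NC_def partition_on_def disjoint_def by blast
  then show ?thesis unfolding block_of_def by simp
qed

lemma nc_perm_in_block:
  assumes "\<pi> \<in> NC n" "V \<in> \<pi>" "i \<in> V"
  shows "nc_perm \<pi> i \<in> V"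
proof -
  have fin: "finite V" using assms finite_block by blast
  have ne: "V \<noteq> {}" using assms by blast
  show ?thesis
  proof (cases "i = Max V")
    case True
    then show ?thesis using assms fin ne by (simp add: nc_perm_def block_of_eq)
  next
    case False
    then have "i < Max V" using assms fin by (simp add: order.not_eq_order_implies_strict)
    then have "{j\<in>V. i < j} \<noteq> {}" using Max_in[OF fin ne] by blast
    then have "Min {j\<in>V. i < j} \<in> {j\<in>V. i < j}" using fin by (intro Min_in) auto
    then show ?thesis using assms False ne by (simp add: nc_perm_def block_of_eq)
  qed
qed

lemma nc_perm_permutes:
  assumes "\<pi> \<in> NC n"
  shows "nc_perm \<pi> permutes {1..n}"
proof -
  have U: "\<Union>\<pi> = {1..n}" and dis: "disjoint \<pi>"
    using assms unfolding NC_def partition_on_def by auto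
  have out: "nc_perm \<pi> i = i" if "i \<notin> {1..n}" for i
  proof -
    have "{V\<in>\<pi>. i \<in> V} = {}" using that U by blast
    then have "block_of \<pi> i = {}" unfolding block_of_def by (simp only: Union_empty)
    then show ?thesis by (simp add: nc_perm_def)
  qed
  have maps: "nc_perm \<pi> i \<in> {1..n}" if "i \<in> {1..n}" for i
    using nc_perm_in_block[OF assms] that U by blast
  have surj: "\<exists>i\<in>{1..n}. nc_perm \<pi> i = k" if k: "k \<in> {1..n}" for k
  proof -
    obtain V where V: "V \<in> \<pi>" "k \<in> V" using k U by blast
    have fin: "finite V" using assms V finite_block by blast
    have ne: "V \<noteq> {}" using V by blast
    have sub: "V \<subseteq> {1..n}" using V U by blast
    have eq: "nc_perm \<pi> i = (if i = Max V then Min V else Min {j\<in>V. i < j})" if "i \<in> V" for i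
      using that assms V ne by (simp add: nc_perm_def block_of_eq)
    show ?thesis
    proof (cases "k = Min V")
      case True
      have "Max V \<in> V" using fin ne by simp
      then show ?thesis using eq[of "Max V"] True sub by auto
    next
      case False
      define i where "i = Max {j\<in>V. j < k}"
      have "Min V < k" using fin V False by (simp add: order.not_eq_order_implies_strict)
      then have "{j\<in>V. j < k} \<noteq> {}" using Min_in[OF fin ne] by blast
      then have i: "i \<in> {j\<in>V. j < k}" unfolding i_def using fin by (intro Max_in) auto
      have "i \<noteq> Max V" using i V fin by (metis (no_types, lifting) Max_ge leD mem_Collect_eq)
      moreover have "Min {j\<in>V. i < j} = k"
      proof (rule Min_eqI)
        show "finite {j\<in>V. i < j}" using fin by simp
        show "k \<in> {j\<in>V. i < j}" using i V by simp
        show "k \<le> j" if "j \<in> {j\<in>V. i < j}" for j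
        proof (rule ccontr)
          assume "\<not> k \<le> j"
          then have "j \<in> {j\<in>V. j < k}" using that by simp
          then have "j \<le> i" unfolding i_def using fin by (intro Max_ge) auto
          then show False using that by simp
        qed
      qed
      ultimately show ?thesis using eq[of i] i sub by auto
    qed
  qed
  have "nc_perm \<pi> ` {1..n} = {1..n}" using maps surj by force
  then have "bij_betw (nc_perm \<pi>) {1..n} {1..n}"
    by (simp add: bij_betw_def eq_card_imp_inj_on)
  then show ?thesis using out by (intro bij_imp_permutes) auto
qed

lemma meandric_system_permutes:
  assumes "\<pi> \<in> NC n" "\<rho> \<in> NC n"
  shows "meandric_system n \<pi> \<rho> permutes {1..2*n}"
proof -
  let ?M = "meandric_system n \<pi> \<rho>" and ?p = "nc_perm \<pi>" and ?q = "nc_perm \<rho>"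
  have p: "?p permutes {1..n}" and q: "?q permutes {1..n}"
    using assms nc_perm_permutes by auto
  have q': "inv ?q permutes {1..n}" and p': "inv ?p permutes {1..n}"
    using p q permutes_inv by auto
  have odd_val: "?M (2 * i - 1) = 2 * inv ?p i" if i: "i \<in> {1..n}" for i
  proof -
    obtain m where "i = Suc m" using i by (cases i) auto
    then show ?thesis using i by (simp add: meandric_system_def)
  qed
  have even_val: "?M (2 * i) = 2 * ?q i - 1" if i: "i \<in> {1..n}" for i
    using i by (simp add: meandric_system_def)
  have parity: "\<exists>i\<in>{1..n}. k = 2 * i \<or> k = 2 * i - 1" if k: "k \<in> {1..2*n}" for k
  proof (cases "even k")
    case True
    then obtain i where "k = 2 * i" by blast
    then show ?thesis using k by (intro bexI[of _ i]) auto
  next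
    case False
    then obtain i where "k = 2 * i + 1" by (rule oddE)
    then show ?thesis using k by (intro bexI[of _ "Suc i"]) auto
  qed
  have bound: "2 * i \<in> {1..2*n}" "2 * i - 1 \<in> {1..2*n}" if "i \<in> {1..n}" for i
    using that by auto
  have maps: "?M k \<in> {1..2*n}" if "k \<in> {1..2*n}" for k
    using parity[OF that] odd_val even_val bound
      permutes_in_image[OF p'] permutes_in_image[OF q] by metis
  have surj: "\<exists>j\<in>{1..2*n}. ?M j = k" if k: "k \<in> {1..2*n}" for k
  proof -
    obtain i where i: "i \<in> {1..n}" and "k = 2 * i \<or> k = 2 * i - 1" using parity[OF k] by blast
    then show ?thesis
    proof (elim disjE)
      assume "k = 2 * i"
      moreover have "?p i \<in> {1..n}" using i permutes_in_image[OF p] by blast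
      ultimately show ?thesis
        using odd_val bound(2) permutes_inverses(2)[OF p] by metis
    next
      assume "k = 2 * i - 1"
      moreover have "inv ?q i \<in> {1..n}" using i permutes_in_image[OF q'] by blast
      ultimately show ?thesis
        using even_val bound(1) permutes_inverses(1)[OF q] by metis
    qed
  qed
  have "?M ` {1..2*n} = {1..2*n}" using maps surj by force
  then have "bij_betw ?M {1..2*n} {1..2*n}" by (simp add: bij_betw_def eq_card_imp_inj_on)
  then show ?thesis
    by (intro bij_imp_permutes) (auto simp: meandric_system_def)
qed

lemma full_in_NC: "n \<ge> 1 \<Longrightarrow> {{1..n}} \<in> NC n"
  by (simp add: NC_def noncrossing_def partition_on_space)

lemma card_block_less:
  assumes "\<pi> \<in> NC n" "\<pi> \<noteq> {{1..n}}" "V \<in> \<pi>"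
  shows "card V < n"
proof -
  have U: "\<Union>\<pi> = {1..n}" and dis: "disjoint \<pi>" and ne: "{} \<notin> \<pi>"
    using assms unfolding NC_def partition_on_def by auto
  have "V \<noteq> {1..n}"
  proof
    assume V: "V = {1..n}"
    have all: "W = V" if "W \<in> \<pi>" for W
    proof (rule ccontr)
      assume "W \<noteq> V"
      then have "W \<inter> V = {}" using dis that assms(3) unfolding disjoint_def by blast
      moreover have "W \<subseteq> V" using Union_upper[OF that] U V by simp
      ultimately have "W = {}" by blast
      then show False using ne that by simp
    qed
    have "\<pi> = {V}"
    proof (rule set_eqI, rule iffI)
      show "W \<in> {V}" if "W \<in> \<pi>" for W by (simp only: all[OF that] singleton_iff)
      show "W \<in> \<pi>" if "W \<in> {V}" for W using that assms(3) by (simp only: singleton_iff)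
    qed
    then show False using V assms(2) by (simp only: simp_thms)
  qed
  moreover have "V \<subseteq> {1..n}" using U assms(3) by blast
  ultimately have "card V < card {1..n}" by (intro psubset_card_mono) auto
  then show ?thesis by simp
qed

lemma sum_NC_split:
  fixes \<kappa> :: "nat \<Rightarrow> complex"
  assumes "n \<ge> 1"
  shows "(\<Sum>\<pi>\<in>NC n. \<Prod>V\<in>\<pi>. \<kappa> (card V))
       = \<kappa> n + (\<Sum>\<pi>\<in>NC n - {{{1..n}}}. \<Prod>V\<in>\<pi>. \<kappa> (card V))"
  by (subst sum.remove[OF finite_NC full_in_NC[OF assms]]) simp

lemma rest_cong:
  fixes \<kappa> \<kappa>' :: "nat \<Rightarrow> complex"
  assumes "\<And>m. m < n \<Longrightarrow> \<kappa> m = \<kappa>' m"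
  shows "(\<Sum>\<pi>\<in>NC n - {{{1..n}}}. \<Prod>V\<in>\<pi>. \<kappa> (card V))
       = (\<Sum>\<pi>\<in>NC n - {{{1..n}}}. \<Prod>V\<in>\<pi>. \<kappa>' (card V))"
  using assms card_block_less by (intro sum.cong prod.cong refl) auto

lemma ex1_cumulants:
  "\<exists>!\<kappa> :: nat \<Rightarrow> complex. \<kappa> 0 = 0 \<and> (\<forall>n\<ge>1. m n = (\<Sum>\<pi>\<in>NC n. \<Prod>V\<in>\<pi>. \<kappa> (card V)))"
proof (rule ex_ex1I)
  define P where "P = (\<lambda>(f :: nat \<Rightarrow> complex) n r. r =
     (if n = 0 then 0 else m n - (\<Sum>\<pi>\<in>NC n - {{{1..n}}}. \<Prod>V\<in>\<pi>. f (card V))))"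
  have "\<exists>f. \<forall>n. P f n (f n)"
  proof (rule dependent_wellorder_choice)
    fix r and f g :: "nat \<Rightarrow> complex" and n :: nat
    assume "\<And>y. y < n \<Longrightarrow> f y = g y"
    then show "P f n r = P g n r" unfolding P_def using rest_cong[of n f g] by simp
  next
    show "\<exists>r. P f n r" for n f unfolding P_def by simp
  qed
  then obtain f where f: "\<And>n. P f n (f n)" by blast
  have "f 0 = 0" using f[of 0] unfolding P_def by simp
  moreover have "m n = (\<Sum>\<pi>\<in>NC n. \<Prod>V\<in>\<pi>. f (card V))" if "n \<ge> 1" for n
    using f[of n] that sum_NC_split[OF that, of f] unfolding P_def by simp
  ultimately show "\<exists>\<kappa>. \<kappa> 0 = 0 \<and> (\<forall>n\<ge>1. m n = (\<Sum>\<pi>\<in>NC n. \<Prod>V\<in>\<pi>. \<kappa> (card V)))" by blast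
next
  fix \<kappa> \<kappa>' :: "nat \<Rightarrow> complex"
  assume 1: "\<kappa> 0 = 0 \<and> (\<forall>n\<ge>1. m n = (\<Sum>\<pi>\<in>NC n. \<Prod>V\<in>\<pi>. \<kappa> (card V)))"
    and 2: "\<kappa>' 0 = 0 \<and> (\<forall>n\<ge>1. m n = (\<Sum>\<pi>\<in>NC n. \<Prod>V\<in>\<pi>. \<kappa>' (card V)))"
  have "\<kappa> n = \<kappa>' n" for n
  proof (induction n rule: less_induct)
    case (less n)
    show ?case
    proof (cases "n = 0")
      case False
      then have n: "n \<ge> 1" by simp
      have "\<kappa> n + (\<Sum>\<pi>\<in>NC n - {{{1..n}}}. \<Prod>V\<in>\<pi>. \<kappa> (card V))
          = \<kappa>' n + (\<Sum>\<pi>\<in>NC n - {{{1..n}}}. \<Prod>V\<in>\<pi>. \<kappa>' (card V))"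
        using 1 2 n sum_NC_split[OF n] by metis
      then show ?thesis using rest_cong[of n \<kappa> \<kappa>'] less by simp
    qed (use 1 2 in simp)
  qed
  then show "\<kappa> = \<kappa>'" by blast
qed

lemma free_cumulant_0: "free_cumulant \<mu> 0 = 0"
  and moment_cumulant:
    "n \<ge> 1 \<Longrightarrow> moment \<mu> n = (\<Sum>\<pi>\<in>NC n. \<Prod>V\<in>\<pi>. free_cumulant \<mu> (card V))"
  using theI'[OF ex1_cumulants[of "moment \<mu>"]] unfolding free_cumulant_def by blast+

lemma free_cumulant_eqI:
  assumes "\<kappa> 0 = 0"
    and "\<And>n. n \<ge> 1 \<Longrightarrow> moment \<mu> n = (\<Sum>\<pi>\<in>NC n. \<Prod>V\<in>\<pi>. \<kappa> (card V))"
  shows "free_cumulant \<mu> = \<kappa>"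
  unfolding free_cumulant_def using assms
  by (intro the1_equality ex1_cumulants) blast

lemma vector_space_smult: "vector_space (smult :: complex \<Rightarrow> complex poly \<Rightarrow> complex poly)"
  by unfold_locales (auto simp: smult_add_right smult_add_left)

lemma vector_space_times: "vector_space ((*) :: complex \<Rightarrow> complex \<Rightarrow> complex)"
  by unfold_locales (auto simp: algebra_simps)

lemma linear_poly_iff:
  "Vector_Spaces.linear smult (*) (\<mu> :: complex poly \<Rightarrow> complex) \<longleftrightarrow>
     (\<forall>p q. \<mu> (p + q) = \<mu> p + \<mu> q) \<and> (\<forall>c p. \<mu> (smult c p) = c * \<mu> p)"
  using vector_space_smult vector_space_times
  by (simp add: Vector_Spaces.linear_iff)

lemma unital_functional_expand:
  assumes "unital_functional \<mu>"
  shows "\<mu> p = (\<Sum>i\<le>degree p. coeff p i * moment \<mu> i)"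
proof -
  have add: "\<mu> (p + q) = \<mu> p + \<mu> q" and sc: "\<mu> (smult c p) = c * \<mu> p" for p q c
    using assms unfolding unital_functional_def linear_poly_iff by auto
  have zero: "\<mu> 0 = 0" using sc[of 0 0] by simp
  have sum: "\<mu> (\<Sum>i\<in>A. f i) = (\<Sum>i\<in>A. \<mu> (f i))" for f :: "nat \<Rightarrow> complex poly" and A
    by (induction A rule: infinite_finite_induct) (auto simp: add zero)
  have "\<mu> p = \<mu> (\<Sum>i\<le>degree p. monom (coeff p i) i)" by (simp add: poly_as_sum_of_monoms)
  also have "\<dots> = (\<Sum>i\<le>degree p. \<mu> (smult (coeff p i) (monom 1 i)))"
    by (simp add: sum smult_monom)
  finally show ?thesis by (simp add: sc)
qed

lemma unital_functional_eqI:
  assumes "unital_functional \<mu>" "unital_functional \<eta>"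
    and "\<And>n. n \<ge> 1 \<Longrightarrow> moment \<mu> n = moment \<eta> n"
  shows "\<mu> = \<eta>"
proof
  have "moment \<mu> n = moment \<eta> n" for n
    using assms by (cases "n = 0") (auto simp: unital_functional_def monom_0 simp flip: one_pCons)
  then show "\<mu> p = \<eta> p" for p
    by (subst (1 2) unital_functional_expand) (simp_all only: assms)
qed

lemma ex_functional_with_moments:
  "\<exists>\<mu>. unital_functional \<mu> \<and> (\<forall>n\<ge>1. moment \<mu> n = m n)"
proof -
  define m' where "m' n = (if n = 0 then 1 else m n)" for n
  define \<mu> where "\<mu> p = (\<Sum>i\<le>degree p. coeff p i * m' i)" for p
  have \<mu>: "\<mu> p = (\<Sum>i\<le>N. coeff p i * m' i)" if "degree p \<le> N" for p N
    unfolding \<mu>_def using that by (intro sum.mono_neutral_left) (auto simp: coeff_eq_0)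
  have "\<mu> (p + q) = \<mu> p + \<mu> q" for p q
  proof -
    let ?N = "max (degree p) (degree q)"
    have "\<mu> (p + q) = (\<Sum>i\<le>?N. coeff (p + q) i * m' i)"
      using degree_add_le_max by (intro \<mu>)
    also have "\<dots> = \<mu> p + \<mu> q"
      by (simp add: \<mu>[of p ?N] \<mu>[of q ?N] distrib_right sum.distrib)
    finally show ?thesis .
  qed
  moreover have "\<mu> (smult c p) = c * \<mu> p" for c p
  proof -
    have "\<mu> (smult c p) = (\<Sum>i\<le>degree p. coeff (smult c p) i * m' i)"
      using degree_smult_le by (intro \<mu>)
    then show ?thesis by (simp add: \<mu>_def sum_distrib_left mult.assoc)
  qed
  moreover have mom: "moment \<mu> n = m' n" for n
    by (simp add: \<mu>_def degree_monom_eq if_distrib[of "\<lambda>x. x * _"] sum.delta cong: if_cong)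
  moreover have "\<mu> 1 = 1"
    using mom[of 0] by (simp add: m'_def monom_0 flip: one_pCons)
  ultimately show ?thesis
    unfolding unital_functional_def linear_poly_iff by (intro exI[of _ \<mu>]) (simp add: m'_def)
qed

lemma ex1_functional_with_cumulants:
  "\<exists>!\<mu>. unital_functional \<mu> \<and> (\<forall>n\<ge>1. free_cumulant \<mu> n = \<kappa> n)"
proof (rule ex_ex1I)
  define \<kappa>' where "\<kappa>' n = (if n = 0 then 0 else \<kappa> n)" for n
  obtain \<mu> where "unital_functional \<mu>"
    and "\<And>n. n \<ge> 1 \<Longrightarrow> moment \<mu> n = (\<Sum>\<pi>\<in>NC n. \<Prod>V\<in>\<pi>. \<kappa>' (card V))"
    using ex_functional_with_moments[of "\<lambda>n. \<Sum>\<pi>\<in>NC n. \<Prod>V\<in>\<pi>. \<kappa>' (card V)"] by blast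
  moreover from this(2) have "free_cumulant \<mu> = \<kappa>'"
    by (intro free_cumulant_eqI) (auto simp: \<kappa>'_def)
  then have "\<forall>n\<ge>1. free_cumulant \<mu> n = \<kappa> n" by (simp add: \<kappa>'_def)
  ultimately show "\<exists>\<mu>. unital_functional \<mu> \<and> (\<forall>n\<ge>1. free_cumulant \<mu> n = \<kappa> n)"
    by blast
next
  fix \<mu> \<eta>
  assume 1: "unital_functional \<mu> \<and> (\<forall>n\<ge>1. free_cumulant \<mu> n = \<kappa> n)"
    and 2: "unital_functional \<eta> \<and> (\<forall>n\<ge>1. free_cumulant \<eta> n = \<kappa> n)"
  have "free_cumulant \<mu> n = free_cumulant \<eta> n" for n
    using 1 2 by (cases "n = 0") (auto simp: free_cumulant_0)
  then show "\<mu> = \<eta>"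
    using 1 2 by (intro unital_functional_eqI) (auto simp: moment_cumulant)
qed

lemma free_conv_power:
  shows unital_free_conv_power: "unital_functional (free_conv_power \<mu> s)"
    and R_transform_free_conv_power:
      "R_transform (free_conv_power \<mu> s) = fps_const (of_real s) * R_transform \<mu>"
proof -
  have "(R_transform \<eta> = fps_const (of_real s) * R_transform \<mu>) \<longleftrightarrow>
        (\<forall>n\<ge>1. free_cumulant \<eta> n = of_real s * free_cumulant \<mu> n)" for \<eta>
    by (simp add: fps_eq_iff R_transform_def if_distrib[of "\<lambda>x. _ * x"]) (simp add: Suc_le_eq)
  then have "\<exists>!\<eta>. unital_functional \<eta> \<and> R_transform \<eta> = fps_const (of_real s) * R_transform \<mu>"
    using ex1_functional_with_cumulants[of "\<lambda>n. of_real s * free_cumulant \<mu> n"] by simp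
  from theI'[OF this] show "unital_functional (free_conv_power \<mu> s)"
    and "R_transform (free_conv_power \<mu> s) = fps_const (of_real s) * R_transform \<mu>"
    unfolding free_conv_power_def by blast+
qed

lemma free_cumulant_free_conv_power:
  "free_cumulant (free_conv_power \<mu> s) n = of_real s * free_cumulant \<mu> n"
  using arg_cong[OF R_transform_free_conv_power[of \<mu> s], of "\<lambda>F. fps_nth F n"]
  by (cases "n = 0") (simp_all add: R_transform_def free_cumulant_0)

end

theory Submission
  imports Defs
begin

text \<open>Every free cumulant is the corresponding moment minus a sum of products of at least two
  lower cumulants. If all moments are \<open>O(t)\<close>, these products are \<open>O(t\<^sup>2)\<close>, so cumulants and
  moments agree to first order in \<open>t\<close>. For \<open>\<nu>\<^sub>t\<close> the first-order coefficients of the moments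
  are \<open>m\<^sub>n\<^sup>(\<^sup>1\<^sup>)\<close>, and the free convolution power \<open>1/t\<close> extracts exactly these coefficients.\<close>

text \<open>A single block would have to be all of \<open>{1..n}\<close>, and
  \<open>n \<ge> 1\<close> excludes the empty partition. The second block provides the extra small
  factor in the estimate of the products.\<close>

lemma card_NC_ge_2:
  assumes "\<pi> \<in> NC n" "\<pi> \<noteq> {{1..n}}" "n \<ge> 1"
  shows "card \<pi> \<ge> 2"
proof -
  have part: "partition_on {1..n} \<pi>"
    using assms(1) by (simp add: NC_def)
  have U: "\<Union>\<pi> = {1..n}"
    using part by (simp add: partition_on_def)
  have "finite \<pi>"
    using part by (rule finite_elements[rotated]) simp
  moreover have "card \<pi> \<noteq> 0"
    using U \<open>finite \<pi>\<close> \<open>n \<ge> 1\<close> by auto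
  moreover have "card \<pi> \<noteq> 1"
    using U assms(2) by (auto simp: card_1_singleton_iff)
  ultimately show ?thesis by linarith
qed

text \<open>Strong induction applies because every block of a partition other than
  \<open>{{1..n}}\<close> has fewer than \<open>n\<close> elements. Here \<open>c\<close> plays the
  role of the small parameter \<open>t\<close>.\<close>

lemma tendsto_free_cumulant_divide:
  fixes \<mu> :: "'a \<Rightarrow> complex poly \<Rightarrow> complex" and c :: "'a \<Rightarrow> complex"
  assumes c: "(c \<longlongrightarrow> 0) F"
    and mom: "\<And>n. n \<ge> 1 \<Longrightarrow> ((\<lambda>x. moment (\<mu> x) n / c x) \<longlongrightarrow> L n) F"
    and "n \<ge> 1"
  shows "((\<lambda>x. free_cumulant (\<mu> x) n / c x) \<longlongrightarrow> L n) F"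
  using \<open>n \<ge> 1\<close>
proof (induction n rule: less_induct)
  case (less n)
  let ?\<kappa> = "\<lambda>x. free_cumulant (\<mu> x)"
  let ?R = "NC n - {{{1..n}}}"
  have prod: "((\<lambda>x. (\<Prod>V\<in>\<pi>. ?\<kappa> x (card V)) / c x) \<longlongrightarrow> 0) F" if \<pi>: "\<pi> \<in> ?R" for \<pi>
  proof -
    have "card \<pi> \<ge> 2"
      using \<pi> less.prems card_NC_ge_2 by blast
    then obtain k where k: "card \<pi> = Suc (Suc k)"
      by (metis add_2_eq_Suc le_Suc_ex)
    have "((\<lambda>x. ?\<kappa> x (card V) / c x) \<longlongrightarrow> L (card V)) F" if "V \<in> \<pi>" for V
    proof (rule less.IH)
      show "card V < n" using \<pi> that card_block_less by blast
      have "V \<noteq> {}" "finite V"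
        using \<pi> that finite_block by (auto simp: NC_def partition_on_def)
      then show "card V \<ge> 1" by (simp add: Suc_le_eq card_gt_0_iff)
    qed
    \<comment> \<open>Scaling each of the \<open>k + 2\<close> factors by \<open>1 / c x\<close>
      divides by \<open>c x\<close> once per block, but only one division is wanted; the surplus
      \<open>c x ^ Suc k\<close> forces the limit 0.\<close>
    then have "((\<lambda>x. (\<Prod>V\<in>\<pi>. ?\<kappa> x (card V) / c x) * c x ^ Suc k)
        \<longlongrightarrow> (\<Prod>V\<in>\<pi>. L (card V)) * 0 ^ Suc k) F"
      by (intro tendsto_intros c)
    \<comment> \<open>Where \<open>c x = 0\<close>, both sides are 0 by the convention for division
      by zero.\<close>
    moreover have "(\<Prod>V\<in>\<pi>. ?\<kappa> x (card V) / c x) * c x ^ Suc k = (\<Prod>V\<in>\<pi>. ?\<kappa> x (card V)) / c x" for x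
      by (cases "c x = 0") (simp_all add: prod_dividef k)
    ultimately show ?thesis by simp
  qed
  have "((\<lambda>x. moment (\<mu> x) n / c x - (\<Sum>\<pi>\<in>?R. (\<Prod>V\<in>\<pi>. ?\<kappa> x (card V)) / c x))
      \<longlongrightarrow> L n - (\<Sum>\<pi>\<in>?R. 0)) F"
    by (intro tendsto_diff tendsto_sum mom prod less.prems)
  \<comment> \<open>The one-block partition contributes exactly the cumulant of order
    \<open>n\<close>.\<close>
  moreover have "moment (\<mu> x) n / c x - (\<Sum>\<pi>\<in>?R. (\<Prod>V\<in>\<pi>. ?\<kappa> x (card V)) / c x) = ?\<kappa> x n / c x" for x
    using moment_cumulant[OF less.prems, of "\<mu> x"] sum_NC_split[OF less.prems, of "?\<kappa> x"]
    by (simp add: add_divide_distrib sum_divide_distrib)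
  ultimately show ?case by simp
qed

text \<open>Each moment is a fixed polynomial in finitely many cumulants, hence continuous in
  them.\<close>

lemma tendsto_moment_if_free_cumulants:
  assumes "\<And>n. n \<ge> 1 \<Longrightarrow> ((\<lambda>x. free_cumulant (\<mu> x) n) \<longlongrightarrow> free_cumulant \<eta> n) F"
    and "n \<ge> 1"
  shows "((\<lambda>x. moment (\<mu> x) n) \<longlongrightarrow> moment \<eta> n) F"
proof -
  have "((\<lambda>x. free_cumulant (\<mu> x) m) \<longlongrightarrow> free_cumulant \<eta> m) F" for m
    using assms(1)[of m] by (cases "m = 0") (simp_all add: free_cumulant_0)
  then show ?thesis
    unfolding moment_cumulant[OF \<open>n \<ge> 1\<close>] by (intro tendsto_intros)
qed

lemma tendsto_sum_power_divide:
  fixes a :: "nat \<Rightarrow> complex"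
  assumes "n \<ge> 1"
  shows "((\<lambda>t. (\<Sum>k=1..n. a k * of_real t ^ k) / of_real t) \<longlongrightarrow> a 1) (at_right 0)"
proof -
  have "((\<lambda>t. \<Sum>k=1..n. a k * of_real t ^ (k - 1)) \<longlongrightarrow> (\<Sum>k=1..n. a k * of_real 0 ^ (k - 1)))
      (at_right (0::real))"
    by (intro tendsto_intros)
  \<comment> \<open>Since \<open>0 ^ 0 = 1\<close>, only the summand \<open>k = 1\<close>
    survives.\<close>
  moreover have "(\<Sum>k=1..n. a k * of_real 0 ^ (k - 1)) = a 1"
    using assms by (subst sum.atLeast_Suc_atMost) (auto intro!: sum.neutral simp: power_0_left)
  \<comment> \<open>Cancelling one power needs \<open>t \<noteq> 0\<close>, which holds to the right
    of 0, and \<open>k \<ge> 1\<close>, so that \<open>k - 1\<close> is not truncated.\<close>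
  moreover have ev: "\<forall>\<^sub>F t in at_right (0::real). (\<Sum>k=1..n. a k * of_real t ^ (k - 1))
      = (\<Sum>k=1..n. a k * of_real t ^ k) / of_real t"
    using eventually_at_right_less[of "0::real"]
    by eventually_elim (auto simp: sum_divide_distrib power_diff intro!: sum.cong)
  ultimately show ?thesis
    unfolding tendsto_cong[OF ev, symmetric] by (simp only:)
qed

theorem proposition5p7:
  fixes \<nu> :: "complex poly \<Rightarrow> complex"
    and \<nu>t :: "real \<Rightarrow> complex poly \<Rightarrow> complex"
  assumes "unital_functional \<nu>"
    and "\<And>n. n \<ge> 1 \<Longrightarrow> free_cumulant \<nu> (2 * n - 1) = 0"
    and "\<And>n. n \<ge> 1 \<Longrightarrow> free_cumulant \<nu> (2 * n) = of_nat (meandric_number n 1)"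
    and "\<And>t. t > 0 \<Longrightarrow> unital_functional (\<nu>t t)"
    and "\<And>t n. t > 0 \<Longrightarrow> n \<ge> 1 \<Longrightarrow> \<nu>t t (monom 1 (2 * n - 1)) = 0"
    and "\<And>t n. t > 0 \<Longrightarrow> n \<ge> 1 \<Longrightarrow>
           \<nu>t t (monom 1 (2 * n)) = (\<Sum>k=1..n. of_nat (meandric_number n k) * of_real t ^ k)"
  shows "\<forall>n\<ge>1. ((\<lambda>t. free_conv_power (\<nu>t t) (1 / t) (monom 1 n)) \<longlongrightarrow> \<nu> (monom 1 n)) (at_right 0)"
proof -
  have moment_limit:
    "((\<lambda>t. moment (\<nu>t t) m / of_real t) \<longlongrightarrow> free_cumulant \<nu> m) (at_right 0)" if "m \<ge> 1" for m
  proof (cases "even m")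
    case True
    then obtain j where m: "m = 2 * j" by blast
    with that have j: "j \<ge> 1" by simp
    have ev: "\<forall>\<^sub>F t in at_right 0. moment (\<nu>t t) m / of_real t
        = (\<Sum>k=1..j. of_nat (meandric_number j k) * of_real t ^ k) / of_real t"
      using eventually_at_right_less[of "0::real"]
      by eventually_elim (simp only: m assms(6) j)
    have "((\<lambda>t. moment (\<nu>t t) m / of_real t) \<longlongrightarrow> of_nat (meandric_number j 1)) (at_right 0)"
      unfolding tendsto_cong[OF ev] by (rule tendsto_sum_power_divide[OF j])
    then show ?thesis
      unfolding m assms(3)[OF j] .
  next
    case False
    then obtain i where "m = 2 * i + 1" by (rule oddE)
    \<comment> \<open>The hypotheses index odd orders as \<open>2 * n - 1\<close> with
      \<open>n \<ge> 1\<close>, hence the shift to \<open>Suc i\<close>.\<close>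
    then have m: "m = 2 * Suc i - 1" by simp
    have "\<forall>\<^sub>F t in at_right 0. moment (\<nu>t t) m / of_real t = 0"
      using eventually_at_right_less[of "0::real"]
      by eventually_elim (use assms(5)[of _ "Suc i"] m in simp)
    then show ?thesis
      using assms(2)[of "Suc i"] m by (simp add: tendsto_eventually)
  qed
  have cumulant_limit:
    "((\<lambda>t. free_cumulant (\<nu>t t) m / of_real t) \<longlongrightarrow> free_cumulant \<nu> m) (at_right 0)"
    if "m \<ge> 1" for m
  proof (rule tendsto_free_cumulant_divide[where \<mu> = \<nu>t and c = of_real, OF _ moment_limit that])
    show "(complex_of_real \<longlongrightarrow> 0) (at_right 0)"
      using tendsto_of_real[OF tendsto_ident_at, of 0 "{0<..}"] by simp
  qed
  have "((\<lambda>t. moment (free_conv_power (\<nu>t t) (1 / t)) n) \<longlongrightarrow> moment \<nu> n) (at_right 0)"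
    if "n \<ge> 1" for n
  proof (rule tendsto_moment_if_free_cumulants[OF _ that])
    show "((\<lambda>t. free_cumulant (free_conv_power (\<nu>t t) (1 / t)) m) \<longlongrightarrow> free_cumulant \<nu> m)
        (at_right 0)" if "m \<ge> 1" for m
      \<comment> \<open>The convolution power \<open>1 / t\<close> multiplies every cumulant by
        \<open>1 / t\<close>, which is the scaling in \<open>cumulant_limit\<close>.\<close>
      using cumulant_limit[OF that] by (simp add: free_cumulant_free_conv_power)
  qed
  then show ?thesis by blast
qed

end
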